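(* Let $X\neq\{0\}$ be a real Hilbert space, let $m\in\{2,3,\ldots\}$, let $R\colon X\to X$ be a linear isometry with $R^m=\operatorname{Id}$, let $M:=\operatorname{Id}-R$, and let $D:=\ker M=\{x\in X : Rx=x\}$. Then $$\lim_{\gamma\to 0^+}J_{\gamma M}=\operatorname{Id}$$ and $$\lim_{\gamma\to+\infty}J_{\gamma M}=P_D=\frac1m\sum_{k=0}^{m-1}R^k,$$ where the limits are understood in the pointwise sense (i.e., $J_{\gamma M}x$ converges in norm for every $x\in X$) and $P_D$ denotes the orthogonal projector onto the closed linear subspace $D$.
   Context: $\operatorname{Id}$ is the identity operator on $X$. For $\gamma>0$, $J_{\gamma M}:=(\operatorname{Id}+\gamma M)^{-1}$ is the resolvent of $\gamma M$, which is single-valued with full domain $X$ since $\gamma M$ is maximally monotone. *)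

theory Defs
  imports "HOL-Analysis.Analysis"
begin

text \<open>
  The resolvent of a single-valued operator \<open>A\<close> with full domain. The use of \<^const>\<open>inv\<close> is
  meaningful only where \<open>Id + A\<close> is bijective; see \<open>bij_Id_plus_displacement\<close> below.
\<close>

definition resolvent :: "('a::real_vector \<Rightarrow> 'a) \<Rightarrow> 'a \<Rightarrow> 'a" where
  "resolvent A = inv (\<lambda>x. x + A x)"

text \<open>
  The library's \<open>closest_point\<close> requires the Heine-Borel property and hence excludes
  infinite-dimensional spaces. For a closed linear subspace \<open>D\<close> of a Hilbert space, the point
  described here always exists, by the projection theorem.
\<close>

definition orth_projector :: "'a::real_inner set \<Rightarrow> 'a \<Rightarrow> 'a" where
  "orth_projector D x = (THE p. p \<in> D \<and> (\<forall>d\<in>D. orthogonal (x - p) d))"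

lemma orth_projector_eqI:
  assumes D: "subspace D" and p: "p \<in> D" "\<And>d. d \<in> D \<Longrightarrow> orthogonal (x - p) d"
  shows "orth_projector D x = p"
  unfolding orth_projector_def
proof (rule the_equality)
  fix q assume q: "q \<in> D \<and> (\<forall>d\<in>D. orthogonal (x - q) d)"
  have "p - q \<in> D" using D p(1) q by (simp add: subspace_diff)
  then have "(x - q) \<bullet> (p - q) = 0" "(x - p) \<bullet> (p - q) = 0"
    using p(2) q by (auto simp: orthogonal_def)
  then have "(p - q) \<bullet> (p - q) = 0" by (simp add: inner_diff_left)
  then show "q = p" by simp
qed (use p in auto)

lemma bij_Id_plus_displacement:
  fixes R :: "'a::{real_inner, complete_space} \<Rightarrow> 'a"
  assumes R: "\<And>x y. dist (R x) (R y) = dist x y" and \<gamma>: "\<gamma> > 0"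
  shows "bij (\<lambda>x. x + \<gamma> *\<^sub>R (x - R x))"
proof -
  have eq: "y + \<gamma> *\<^sub>R (y - R y) = x \<longleftrightarrow> (1 / (1 + \<gamma>)) *\<^sub>R (x + \<gamma> *\<^sub>R R y) = y" for x y
  proof -
    have y: "y = (1 / (1 + \<gamma>)) *\<^sub>R ((1 + \<gamma>) *\<^sub>R y)" using \<gamma> by simp
    have "(1 / (1 + \<gamma>)) *\<^sub>R (x + \<gamma> *\<^sub>R R y) = y \<longleftrightarrow> x + \<gamma> *\<^sub>R R y = (1 + \<gamma>) *\<^sub>R y"
      by (subst (2) y, subst scaleR_cancel_left) (use \<gamma> in auto)
    then show ?thesis by (auto simp: algebra_simps)
  qed
  have "\<exists>!y. (1 / (1 + \<gamma>)) *\<^sub>R (x + \<gamma> *\<^sub>R R y) = y" for x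
  proof (rule banach_fix_type)
    show "0 \<le> \<gamma> / (1 + \<gamma>)" "\<gamma> / (1 + \<gamma>) < 1" using \<gamma> by auto
    have "dist ((1 / (1 + \<gamma>)) *\<^sub>R (x + \<gamma> *\<^sub>R R y)) ((1 / (1 + \<gamma>)) *\<^sub>R (x + \<gamma> *\<^sub>R R z))
        = \<gamma> / (1 + \<gamma>) * dist y z" for y z
    proof -
      have "(1 / (1 + \<gamma>)) *\<^sub>R (x + \<gamma> *\<^sub>R R y) - (1 / (1 + \<gamma>)) *\<^sub>R (x + \<gamma> *\<^sub>R R z)
          = (\<gamma> / (1 + \<gamma>)) *\<^sub>R (R y - R z)"
        by (simp add: algebra_simps)
      then show ?thesis using \<gamma> R[of y z] by (simp add: dist_norm)
    qed
    then show "\<forall>y z. dist ((1 / (1 + \<gamma>)) *\<^sub>R (x + \<gamma> *\<^sub>R R y))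
        ((1 / (1 + \<gamma>)) *\<^sub>R (x + \<gamma> *\<^sub>R R z)) \<le> \<gamma> / (1 + \<gamma>) * dist y z" by simp
  qed
  then show ?thesis unfolding bij_iff eq by blast
qed

end

theory Submission
  imports Defs
begin

text \<open>
  The cyclic average \<open>P = (1/m) \<Sum>\<^sub>k\<^sub><\<^sub>m R\<^sup>k\<close> satisfies \<open>R P = P R = P\<close> because the orbits of \<open>R\<close> close up
  after \<open>m\<close> steps. So \<open>P\<close> maps into the fixed space \<open>D\<close> of \<open>R\<close>; and since \<open>R\<close> preserves inner
  products, \<open>R\<^sup>k x\<close> has the same inner product as \<open>x\<close> with each \<open>d = R\<^sup>k d \<in> D\<close>, which makes
  \<open>x - P x\<close> orthogonal to \<open>D\<close>. Hence \<open>P\<close> is the orthogonal projector onto \<open>D\<close>.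

  Both limits come from two facts about \<open>y = J\<^bsub>\<gamma>M\<^esub> x\<close>, that is, about the solution of
  \<open>y + \<gamma> (y - R y) = x\<close>: \<open>\<parallel>y\<parallel> \<le> \<parallel>x\<parallel>\<close> (\<open>norm_resolvent_le\<close>); and \<open>P y = P x\<close>,
  since \<open>P\<close> annihilates \<open>y - R y\<close>. For small \<open>\<gamma>\<close>, \<open>\<parallel>y - x\<parallel> = \<gamma> \<parallel>y - R y\<parallel> \<le> 2 \<gamma> \<parallel>y\<parallel> \<le> 2 \<gamma> \<parallel>x\<parallel>\<close>.
  For large \<open>\<gamma>\<close>, \<open>\<gamma> \<parallel>y - R y\<parallel> = \<parallel>x - y\<parallel> \<le> 2 \<parallel>x\<parallel>\<close> makes the displacement \<open>y - R y\<close> small,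
  hence so is every \<open>y - R\<^sup>k y\<close> with \<open>k < m\<close>, hence so is their mean
  \<open>y - P y = y - P x\<close> (\<open>norm_diff_cyclic_avg_le\<close>). This gives the explicit rates \<open>O(\<gamma>)\<close> and
  \<open>O(1/\<gamma>)\<close> and avoids a closed formula for the resolvent.
\<close>

definition cyclic_avg :: "nat \<Rightarrow> ('a::real_vector \<Rightarrow> 'a) \<Rightarrow> 'a \<Rightarrow> 'a" where
  "cyclic_avg m R x = (1 / real m) *\<^sub>R (\<Sum>k<m. (R ^^ k) x)"

lemma linear_funpow:
  fixes R :: "'a::real_vector \<Rightarrow> 'a"
  assumes "linear R"
  shows "linear (R ^^ k)"
proof (induction k)
  case 0
  show ?case using linear_id by (simp add: id_def)
next
  case (Suc k)
  then show ?case unfolding funpow.simps using assms by (rule linear_compose)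
qed

lemma linear_cyclic_avg:
  assumes "linear R"
  shows "linear (cyclic_avg m R)"
  unfolding cyclic_avg_def
  by (intro linear_compose_scale_right linear_compose_sum ballI)
    (simp add: linear_funpow[OF assms])

lemma cyclic_avg_shift:
  assumes "R ^^ m = id"
  shows "cyclic_avg m R (R x) = cyclic_avg m R x"
proof -
  have "(\<Sum>k<m. (R ^^ k) (R x)) = (\<Sum>k<m. (R ^^ Suc k) x)"
    by (simp add: funpow_swap1)
  also have "\<dots> = (\<Sum>k<m. (R ^^ k) x)"
    \<comment> \<open>The end points \<open>R\<^sup>m x\<close> and \<open>R\<^sup>0 x\<close> of the two ranges agree.\<close>
    using sum.lessThan_Suc_shift[of "\<lambda>k. (R ^^ k) x" m]
      sum.lessThan_Suc[of "\<lambda>k. (R ^^ k) x" m] assms by simp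
  finally show ?thesis by (simp add: cyclic_avg_def)
qed

lemma cyclic_avg_fixed:
  assumes "linear R" "R ^^ m = id"
  shows "R (cyclic_avg m R x) = cyclic_avg m R x"
proof -
  have "R (cyclic_avg m R x) = cyclic_avg m R (R x)"
    using assms(1) by (simp add: cyclic_avg_def linear_scale linear_sum funpow_swap1)
  then show ?thesis using cyclic_avg_shift[OF assms(2)] by simp
qed

lemma norm_diff_cyclic_avg_le:
  fixes R :: "'a::real_normed_vector \<Rightarrow> 'a"
  assumes R: "\<And>x y. dist (R x) (R y) = dist x y" and m: "m > 0"
  shows "norm (y - cyclic_avg m R y) \<le> real m * norm (y - R y)"
proof -
  have step: "norm (y - (R ^^ k) y) \<le> real k * norm (y - R y)" for k
  proof (induction k)
    case (Suc k)
    have "norm (y - (R ^^ Suc k) y) \<le> norm (y - R y) + norm (R y - R ((R ^^ k) y))"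
      using norm_triangle_ineq[of "y - R y" "R y - R ((R ^^ k) y)"] by simp
    also have "norm (R y - R ((R ^^ k) y)) = norm (y - (R ^^ k) y)"
      using R by (simp flip: dist_norm)
    finally show ?case using Suc by (simp add: algebra_simps)
  qed simp
  have "y - cyclic_avg m R y = (1 / real m) *\<^sub>R (\<Sum>k<m. y - (R ^^ k) y)"
    using m by (simp add: cyclic_avg_def sum_subtractf scaleR_diff_right sum_constant_scaleR)
  then have "norm (y - cyclic_avg m R y) = (1 / real m) * norm (\<Sum>k<m. y - (R ^^ k) y)"
    by simp
  also have "norm (\<Sum>k<m. y - (R ^^ k) y) \<le> (\<Sum>k<m. real m * norm (y - R y))"
    by (intro sum_norm_le order_trans[OF step] mult_right_mono) auto
  finally show ?thesis using m by (simp add: mult_left_mono field_simps)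
qed

lemma linear_isometry_inner:
  fixes R :: "'a::real_inner \<Rightarrow> 'a"
  assumes lin: "linear R" and R: "\<And>x y. dist (R x) (R y) = dist x y"
  shows "R x \<bullet> R y = x \<bullet> y"
proof -
  have n: "norm (R z) = norm z" for z
    using R[of z 0] linear_0[OF lin] by simp
  show ?thesis
    using n[of "x + y"] n[of x] n[of y] by (simp add: dot_norm linear_add[OF lin, symmetric])
qed

lemma orth_projector_fixed_space:
  fixes R :: "'a::real_inner \<Rightarrow> 'a"
  assumes lin: "linear R" and R: "\<And>x y. dist (R x) (R y) = dist x y"
    and m: "m > 0" and per: "R ^^ m = id"
  shows "orth_projector {x. R x = x} x = cyclic_avg m R x"
proof (rule orth_projector_eqI)
  show "subspace {x. R x = x}"
    by (simp add: subspace_def linear_0[OF lin] linear_add[OF lin] linear_scale[OF lin])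
  show "cyclic_avg m R x \<in> {x. R x = x}"
    using cyclic_avg_fixed[OF lin per] by simp
next
  fix d assume "d \<in> {x. R x = x}"
  then have d: "R d = d" by simp
  have "(R ^^ k) x \<bullet> d = x \<bullet> d" for k
  proof (induction k)
    case (Suc k)
    then show ?case
      using linear_isometry_inner[OF lin R, of "(R ^^ k) x" d] d by simp
  qed simp
  then show "orthogonal (x - cyclic_avg m R x) d"
    using m by (simp add: orthogonal_def cyclic_avg_def inner_diff_left inner_sum_left)
qed

lemma resolvent_eq:
  fixes R :: "'a::{real_inner, complete_space} \<Rightarrow> 'a"
  assumes R: "\<And>x y. dist (R x) (R y) = dist x y" and \<gamma>: "\<gamma> > 0"
    and y: "y = resolvent (\<lambda>y. \<gamma> *\<^sub>R (y - R y)) x"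
  shows "y + \<gamma> *\<^sub>R (y - R y) = x"
  unfolding y resolvent_def
  by (rule surj_f_inv_f[OF bij_is_surj[OF bij_Id_plus_displacement[OF R \<gamma>]]])

text \<open>
  The defining equation exhibits \<open>(1 + \<gamma>) y\<close> as \<open>x + \<gamma> R y\<close>, and \<open>\<parallel>R y\<parallel> = \<parallel>y\<parallel>\<close>; so the triangle
  inequality already yields the bound, without appeal to monotonicity.
\<close>

lemma norm_resolvent_le:
  fixes R :: "'a::real_normed_vector \<Rightarrow> 'a"
  assumes lin: "linear R" and R: "\<And>x y. dist (R x) (R y) = dist x y" and \<gamma>: "\<gamma> > 0"
    and eq: "y + \<gamma> *\<^sub>R (y - R y) = x"
  shows "norm y \<le> norm x"
proof -
  have "norm (R y) = norm y"
    using R[of y 0] linear_0[OF lin] by simp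
  moreover have "(1 + \<gamma>) *\<^sub>R y = x + \<gamma> *\<^sub>R R y"
    unfolding eq[symmetric] by (simp add: algebra_simps)
  then have "norm ((1 + \<gamma>) *\<^sub>R y) \<le> norm x + norm (\<gamma> *\<^sub>R R y)"
    by (simp only: norm_triangle_ineq)
  moreover have "norm ((1 + \<gamma>) *\<^sub>R y) = norm y + \<gamma> * norm y"
    using \<gamma> by (simp only: norm_scaleR) (simp add: algebra_simps)
  ultimately show ?thesis using \<gamma> by simp
qed

lemma norm_displacement_resolvent_le:
  fixes R :: "'a::real_normed_vector \<Rightarrow> 'a"
  assumes lin: "linear R" and R: "\<And>x y. dist (R x) (R y) = dist x y" and \<gamma>: "\<gamma> > 0"
    and eq: "y + \<gamma> *\<^sub>R (y - R y) = x"
  shows "\<gamma> * norm (y - R y) \<le> 2 * norm x"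
proof -
  have "\<gamma> *\<^sub>R (y - R y) = x - y" using eq by (simp add: eq_diff_eq add.commute)
  then have "\<gamma> * norm (y - R y) = norm (x - y)" using \<gamma> by (metis abs_of_pos norm_scaleR)
  also have "\<dots> \<le> norm x + norm y" by (rule norm_triangle_ineq4)
  finally show ?thesis using norm_resolvent_le[OF lin R \<gamma> eq] by simp
qed

text \<open>
  The resolvent equation gives \<open>\<parallel>y - x\<parallel> = \<gamma> \<parallel>y - R y\<parallel>\<close>, and the displacement of any vector under an
  isometry fixing the origin is at most twice its norm, whatever \<open>\<gamma>\<close> is.
\<close>

lemma norm_resolvent_diff_le:
  fixes R :: "'a::real_normed_vector \<Rightarrow> 'a"
  assumes lin: "linear R" and R: "\<And>x y. dist (R x) (R y) = dist x y" and \<gamma>: "\<gamma> > 0"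
    and eq: "y + \<gamma> *\<^sub>R (y - R y) = x"
  shows "norm (y - x) \<le> \<gamma> * (2 * norm x)"
proof -
  have Ry: "norm (R y) = norm y"
    using R[of y 0] linear_0[OF lin] by simp
  have "norm (y - x) = \<gamma> * norm (y - R y)"
    unfolding eq[symmetric] using \<gamma> by simp
  also have "\<dots> \<le> \<gamma> * (2 * norm x)"
    using norm_triangle_ineq4[of y "R y"] Ry norm_resolvent_le[OF lin R \<gamma> eq] \<gamma>
    by (intro mult_left_mono) auto
  finally show ?thesis .
qed

text \<open>
  Applying the average to the resolvent equation kills the displacement, so \<open>y\<close> and \<open>x\<close> have the
  same average; it remains to see that \<open>y\<close> is close to its own average.
\<close>

lemma norm_resolvent_diff_cyclic_avg_le:
  fixes R :: "'a::real_normed_vector \<Rightarrow> 'a"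
  assumes lin: "linear R" and R: "\<And>x y. dist (R x) (R y) = dist x y" and \<gamma>: "\<gamma> > 0"
    and m: "m > 0" and per: "R ^^ m = id"
    and eq: "y + \<gamma> *\<^sub>R (y - R y) = x"
  shows "norm (y - cyclic_avg m R x) \<le> real m * (2 * norm x) / \<gamma>"
proof -
  note P = linear_cyclic_avg[OF lin, of m]
  have "cyclic_avg m R x = cyclic_avg m R y"
    unfolding eq[symmetric]
    by (simp add: linear_add[OF P] linear_scale[OF P] linear_diff[OF P] cyclic_avg_shift[OF per])
  then have "norm (y - cyclic_avg m R x) \<le> real m * norm (y - R y)"
    using norm_diff_cyclic_avg_le[OF R m] by simp
  also have "\<dots> \<le> real m * (2 * norm x / \<gamma>)"
    using norm_displacement_resolvent_le[OF lin R \<gamma> eq] \<gamma>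
    by (intro mult_left_mono) (simp_all add: field_simps)
  finally show ?thesis by simp
qed

theorem proposition2p4:
  fixes R M :: "'a::{real_inner, complete_space} \<Rightarrow> 'a" and D :: "'a set" and m :: nat
  assumes "(UNIV :: 'a set) \<noteq> {0}"
    and "m \<ge> 2"
    and "linear R" and "\<And>x y. dist (R x) (R y) = dist x y"
    and "R ^^ m = id"
    and "M = (\<lambda>x. x - R x)"
    and "D = {x. M x = 0}"
  shows "(\<forall>x. ((\<lambda>\<gamma>::real. resolvent (\<lambda>y. \<gamma> *\<^sub>R M y) x) \<longlongrightarrow> x) (at_right 0)) \<and>
    (\<forall>x. ((\<lambda>\<gamma>::real. resolvent (\<lambda>y. \<gamma> *\<^sub>R M y) x) \<longlongrightarrow> orth_projector D x) at_top) \<and>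
    (\<forall>x. orth_projector D x = (1 / real m) *\<^sub>R (\<Sum>k = 0..m - 1. (R ^^ k) x))"
proof -
  note lin = assms(3) and R = assms(4) and per = assms(5)
  have m: "m > 0" using assms(2) by simp
  have D: "D = {x. R x = x}" unfolding assms(6,7) by auto
  have proj: "orth_projector D x = cyclic_avg m R x" for x
    unfolding D by (rule orth_projector_fixed_space[OF lin R m per])
  have res: "resolvent (\<lambda>y. \<gamma> *\<^sub>R M y) x + \<gamma> *\<^sub>R (resolvent (\<lambda>y. \<gamma> *\<^sub>R M y) x
      - R (resolvent (\<lambda>y. \<gamma> *\<^sub>R M y) x)) = x" if "\<gamma> > 0" for \<gamma> x
    by (rule resolvent_eq[OF R that]) (simp add: assms(6))
  have "((\<lambda>\<gamma>::real. resolvent (\<lambda>y. \<gamma> *\<^sub>R M y) x) \<longlongrightarrow> x) (at_right 0)" for x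
  proof (rule LIM_zero_cancel, rule Lim_null_comparison)
    show "\<forall>\<^sub>F \<gamma> in at_right 0.
        norm (resolvent (\<lambda>y. \<gamma> *\<^sub>R M y) x - x) \<le> \<gamma> * (2 * norm x)"
      using eventually_at_right_less[of "0::real"]
      by eventually_elim (rule norm_resolvent_diff_le[OF lin R _ res])
    have "((\<lambda>\<gamma>::real. \<gamma> * (2 * norm x)) \<longlongrightarrow> 0 * (2 * norm x)) (at_right 0)"
      by (intro tendsto_intros)
    then show "((\<lambda>\<gamma>::real. \<gamma> * (2 * norm x)) \<longlongrightarrow> 0) (at_right 0)" by simp
  qed
  moreover have "((\<lambda>\<gamma>::real. resolvent (\<lambda>y. \<gamma> *\<^sub>R M y) x) \<longlongrightarrow> orth_projector D x) at_top" for x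
    unfolding proj
  proof (rule LIM_zero_cancel, rule Lim_null_comparison)
    show "\<forall>\<^sub>F \<gamma> in at_top. norm (resolvent (\<lambda>y. \<gamma> *\<^sub>R M y) x - cyclic_avg m R x)
        \<le> real m * (2 * norm x) / \<gamma>"
      using eventually_gt_at_top[of "0::real"]
      by eventually_elim (rule norm_resolvent_diff_cyclic_avg_le[OF lin R _ m per res])
    show "((\<lambda>\<gamma>::real. real m * (2 * norm x) / \<gamma>) \<longlongrightarrow> 0) at_top"
      by (rule tendsto_divide_0[OF tendsto_const filterlim_at_top_imp_at_infinity[OF filterlim_ident]])
  qed
  moreover have "{0..m - 1} = {..<m}" using m by auto
  then have "orth_projector D x = (1 / real m) *\<^sub>R (\<Sum>k = 0..m - 1. (R ^^ k) x)" for x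
    by (simp only: proj cyclic_avg_def)
  ultimately show ?thesis by blast
qed

end
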